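(* Let $m,n,s$ be positive integers. Suppose that $\Phi\in\mathbb{H}^{m\times n}$ satisfies the $2s$-restricted isometry property (for quaternion vectors) with a constant $\delta_{2s}<\sqrt{2}-1$, and let $\eta\geq 0$. Then, for any $x\in\mathbb{H}^n$ and any $y=\Phi x+e$ with $e\in\mathbb{H}^m$, $\|e\|_2\leq\eta$, every solution $x^{\#}$ of the problem $$\operatorname*{arg\,min}_{z\in\mathbb{H}^n}\|z\|_1\quad\text{subject to}\quad\|\Phi z-y\|_2\leq\eta$$ satisfies $$\|x^{\#}-x\|_2\leq\frac{C_0}{\sqrt{s}}\|x-x_s\|_1+C_1\eta$$ with constants $$C_0=2\cdot\frac{1+(\sqrt{2}-1)\delta_{2s}}{1-(\sqrt{2}+1)\delta_{2s}},\qquad C_1=\frac{4\sqrt{1+\delta_{2s}}}{1-(\sqrt{2}+1)\delta_{2s}},$$ where $x_s$ denotes the best $s$-sparse approximation of $x$.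
   Context: $\mathbb{H}$ is the algebra of real quaternions $q=a+b\mathbf{i}+c\mathbf{j}+d\mathbf{k}$ with conjugate $\overline{q}=a-b\mathbf{i}-c\mathbf{j}-d\mathbf{k}$ and norm $|q|=\sqrt{q\overline{q}}=\sqrt{a^2+b^2+c^2+d^2}$. A matrix $\Phi\in\mathbb{H}^{m\times n}$ acts on column vectors $x\in\mathbb{H}^n$ by the usual matrix-vector multiplication (matrix entries on the left), so it is linear for right scalar multiplication. For $x=(x_1,\dots,x_n)^T\in\mathbb{H}^n$: $\|x\|_p=\left(\sum_i|x_i|^p\right)^{1/p}$ for $p\in[1,\infty)$, and $\|x\|_0$ is the number of nonzero coordinates of $x$. A vector $x$ is $s$-sparse if $\|x\|_0\leq s$. Restricted isometry property: $\Phi\in\mathbb{H}^{m\times n}$ satisfies the $s$-restricted isometry property (for quaternion vectors) with a constant $\delta_s\geq0$ if $(1-\delta_s)\|x\|_2^2\leq\|\Phi x\|_2^2\leq(1+\delta_s)\|x\|_2^2$ for all $s$-sparse $x\in\mathbb{H}^n$. The best $s$-sparse approximation $x_s$ of $x$ is the vector obtained from $x$ by keeping $s$ coordinates with the largest quaternion norms (all coordinates if $s\ge n$) and setting the others to $0$; ties may be broken arbitrarily, as $\|x-x_s\|_1$ does not depend on the choice. *)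

theory Defs
  imports "HOL-Analysis.Analysis"
begin

datatype quat = Quat (q_re: real) (q_i: real) (q_j: real) (q_k: real)

lemma quat_eq_iff:
  "p = q \<longleftrightarrow> q_re p = q_re q \<and> q_i p = q_i q \<and> q_j p = q_j q \<and> q_k p = q_k q"
  by (auto intro: quat.expand)

instantiation quat :: ring_1
begin

definition zero_quat :: quat where "0 = Quat 0 0 0 0"
definition one_quat :: quat where "1 = Quat 1 0 0 0"

definition plus_quat :: "quat \<Rightarrow> quat \<Rightarrow> quat" where
  "p + q = Quat (q_re p + q_re q) (q_i p + q_i q) (q_j p + q_j q) (q_k p + q_k q)"

definition uminus_quat :: "quat \<Rightarrow> quat" where
  "- q = Quat (- q_re q) (- q_i q) (- q_j q) (- q_k q)"

definition minus_quat :: "quat \<Rightarrow> quat \<Rightarrow> quat" where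
  "p - q = Quat (q_re p - q_re q) (q_i p - q_i q) (q_j p - q_j q) (q_k p - q_k q)"

text \<open>Hamilton's product: i i = j j = k k = -1, i j = k, j k = i, k i = j.\<close>
definition times_quat :: "quat \<Rightarrow> quat \<Rightarrow> quat" where
  "p * q = Quat
     (q_re p * q_re q - q_i p * q_i q - q_j p * q_j q - q_k p * q_k q)
     (q_re p * q_i q + q_i p * q_re q + q_j p * q_k q - q_k p * q_j q)
     (q_re p * q_j q - q_i p * q_k q + q_j p * q_re q + q_k p * q_i q)
     (q_re p * q_k q + q_i p * q_j q - q_j p * q_i q + q_k p * q_re q)"

instance
  by standard
    (simp_all add: zero_quat_def one_quat_def plus_quat_def uminus_quat_def minus_quat_def
      times_quat_def algebra_simps)

end

lemma quat_zero_sel [simp]: "q_re 0 = 0" "q_i 0 = 0" "q_j 0 = 0" "q_k 0 = 0"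
  by (simp_all add: zero_quat_def)

lemma quat_one_sel [simp]: "q_re 1 = 1" "q_i 1 = 0" "q_j 1 = 0" "q_k 1 = 0"
  by (simp_all add: one_quat_def)

lemma quat_add_sel [simp]:
  "q_re (p + q) = q_re p + q_re q" "q_i (p + q) = q_i p + q_i q"
  "q_j (p + q) = q_j p + q_j q" "q_k (p + q) = q_k p + q_k q"
  by (simp_all add: plus_quat_def)

lemma quat_uminus_sel [simp]:
  "q_re (- q) = - q_re q" "q_i (- q) = - q_i q" "q_j (- q) = - q_j q" "q_k (- q) = - q_k q"
  by (simp_all add: uminus_quat_def)

lemma quat_diff_sel [simp]:
  "q_re (p - q) = q_re p - q_re q" "q_i (p - q) = q_i p - q_i q"
  "q_j (p - q) = q_j p - q_j q" "q_k (p - q) = q_k p - q_k q"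
  by (simp_all add: minus_quat_def)

lemma quat_mult_sel [simp]:
  "q_re (p * q) = q_re p * q_re q - q_i p * q_i q - q_j p * q_j q - q_k p * q_k q"
  "q_i (p * q) = q_re p * q_i q + q_i p * q_re q + q_j p * q_k q - q_k p * q_j q"
  "q_j (p * q) = q_re p * q_j q - q_i p * q_k q + q_j p * q_re q + q_k p * q_i q"
  "q_k (p * q) = q_re p * q_k q + q_i p * q_j q - q_j p * q_i q + q_k p * q_re q"
  by (simp_all add: times_quat_def)

definition qcnj :: "quat \<Rightarrow> quat" where
  "qcnj q = Quat (q_re q) (- q_i q) (- q_j q) (- q_k q)"

lemma qcnj_sel [simp]:
  "q_re (qcnj q) = q_re q" "q_i (qcnj q) = - q_i q"
  "q_j (qcnj q) = - q_j q" "q_k (qcnj q) = - q_k q"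
  by (simp_all add: qcnj_def)

instantiation quat :: real_algebra_1
begin

definition scaleR_quat :: "real \<Rightarrow> quat \<Rightarrow> quat" where
  "r *\<^sub>R q = Quat (r * q_re q) (r * q_i q) (r * q_j q) (r * q_k q)"

instance
  by standard (simp_all add: scaleR_quat_def quat_eq_iff algebra_simps)

end

lemma quat_scaleR_sel [simp]:
  "q_re (r *\<^sub>R q) = r * q_re q" "q_i (r *\<^sub>R q) = r * q_i q"
  "q_j (r *\<^sub>R q) = r * q_j q" "q_k (r *\<^sub>R q) = r * q_k q"
  by (simp_all add: scaleR_quat_def)

instantiation quat :: real_inner
begin

definition inner_quat :: "quat \<Rightarrow> quat \<Rightarrow> real" where
  "p \<bullet> q = q_re p * q_re q + q_i p * q_i q + q_j p * q_j q + q_k p * q_k q"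

definition norm_quat :: "quat \<Rightarrow> real" where
  "norm q = sqrt ((q_re q)\<^sup>2 + (q_i q)\<^sup>2 + (q_j q)\<^sup>2 + (q_k q)\<^sup>2)"

definition sgn_quat :: "quat \<Rightarrow> quat" where
  "sgn q = q /\<^sub>R norm (q :: quat)"

definition dist_quat :: "quat \<Rightarrow> quat \<Rightarrow> real" where
  "dist p q = norm (p - q :: quat)"

definition uniformity_quat :: "(quat \<times> quat) filter" where
  "uniformity = (INF e\<in>{0 <..}. principal {(p :: quat, q). dist p q < e})"

definition open_quat :: "quat set \<Rightarrow> bool" where
  "open U \<longleftrightarrow> (\<forall>p :: quat\<in>U. eventually (\<lambda>(p', q). p' = p \<longrightarrow> q \<in> U) uniformity)"

instance
proof
  fix p q r :: quat and a :: real
  show "(p \<bullet> p = 0) = (p = 0)"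
    using sum_power2_eq_zero_iff[of "q_re p" "q_i p"] sum_power2_eq_zero_iff[of "q_j p" "q_k p"]
    by (smt (verit) inner_quat_def quat_eq_iff quat_zero_sel power2_eq_square zero_le_power2 mult_zero_left)
qed (simp_all add: inner_quat_def norm_quat_def sgn_quat_def dist_quat_def uniformity_quat_def
      open_quat_def power2_eq_square algebra_simps)

end

lemma mult_qcnj: "q * qcnj q = of_real ((norm q)\<^sup>2)"
  by (simp add: quat_eq_iff of_real_def norm_quat_def power2_eq_square)

lemma norm_mult_quat: "norm (p * q) = norm p * norm (q :: quat)"
  unfolding norm_quat_def real_sqrt_mult[symmetric] quat_mult_sel
  by (rule arg_cong[of _ _ sqrt]) algebra

instance quat :: real_normed_algebra_1
  by standard (simp_all add: norm_mult_quat norm_quat_def[of 1])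

text \<open>
  Vectors are elements of \<^typ>\<open>quat ^ 'n\<close> and matrices of \<^typ>\<open>quat ^ 'n ^ 'm\<close>. The library's
  \<^const>\<open>norm\<close> on vectors is the 2-norm of the coordinatewise norms, and the library's
  matrix-vector product has the matrix entries as left factors.
\<close>

lemma norm_quat_vec: "norm (x :: quat ^ 'n) = sqrt (\<Sum>i\<in>UNIV. (norm (x $ i))\<^sup>2)"
  by (simp add: norm_vec_def L2_set_def)

definition l1_norm :: "quat ^ 'n \<Rightarrow> real" where
  "l1_norm x = (\<Sum>i\<in>UNIV. norm (x $ i))"

definition l0_norm :: "quat ^ 'n \<Rightarrow> nat" where
  "l0_norm x = card {i. x $ i \<noteq> 0}"

definition sparse :: "nat \<Rightarrow> quat ^ 'n \<Rightarrow> bool" where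
  "sparse s x \<longleftrightarrow> l0_norm x \<le> s"

definition restricted_isometry :: "quat ^ 'n ^ 'm \<Rightarrow> nat \<Rightarrow> real \<Rightarrow> bool" where
  "restricted_isometry \<Phi> s \<delta> \<longleftrightarrow> \<delta> \<ge> 0 \<and>
     (\<forall>x. sparse s x \<longrightarrow>
        (1 - \<delta>) * (norm x)\<^sup>2 \<le> (norm (\<Phi> *v x))\<^sup>2 \<and>
        (norm (\<Phi> *v x))\<^sup>2 \<le> (1 + \<delta>) * (norm x)\<^sup>2)"

text \<open>
  A relation rather than a function, since ties between coordinate norms may be broken in any
  way: \<open>S\<close> is one possible set of positions of the \<open>s\<close> largest coordinates (of all
  coordinates, if \<open>s\<close> exceeds the dimension).
\<close>
definition best_sparse_approx :: "nat \<Rightarrow> quat ^ 'n \<Rightarrow> quat ^ 'n \<Rightarrow> bool" where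
  "best_sparse_approx s x v \<longleftrightarrow>
     (\<exists>S. card S = min s CARD('n) \<and>
          (\<forall>i\<in>S. \<forall>j\<in>- S. norm (x $ j) \<le> norm (x $ i)) \<and>
          v = (\<chi> i. if i \<in> S then x $ i else 0))"

lemma best_sparse_approx_exists: "\<exists>v. best_sparse_approx s (x :: quat ^ 'n) v"
proof -
  have "\<exists>S :: 'n set. card S = k \<and> (\<forall>i\<in>S. \<forall>j\<in>- S. norm (x $ j) \<le> norm (x $ i))"
    if "k \<le> CARD('n)" for k
    using that
  proof (induction k)
    case 0
    show ?case by (intro exI[of _ "{}"]) simp
  next
    case (Suc k)
    then obtain S :: "'n set" where S: "card S = k"
      "\<forall>i\<in>S. \<forall>j\<in>- S. norm (x $ j) \<le> norm (x $ i)" by auto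
    let ?N = "(\<lambda>j. norm (x $ j)) ` (- S)"
    have "S \<noteq> UNIV" using S(1) Suc.prems by auto
    then have "- S \<noteq> {}" by auto
    then have "Max ?N \<in> ?N" by (intro Max_in) auto
    then obtain m where m: "m \<in> - S" "norm (x $ m) = Max ?N" by auto
    have "\<forall>j\<in>- S. norm (x $ j) \<le> norm (x $ m)" unfolding m(2) by (auto intro: Max_ge)
    then show ?case using S m(1) by (intro exI[of _ "insert m S"]) (auto simp: card_insert_if)
  qed
  from this[of "min s CARD('n)"] show ?thesis
    unfolding best_sparse_approx_def by auto
qed

end

theory Submission
  imports Defs
begin

text \<open>
  This is Candes's argument. Let \<open>h\<close> be the error, \<open>T\<close> the positions kept in the best \<open>s\<close>-sparse
  approximation, and cut the complement of \<open>T\<close> into blocks of size \<open>s\<close> in order of decreasing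
  coordinates of \<open>h\<close>. Minimality of the 1-norm controls \<open>h\<close> outside \<open>T\<close> by \<open>h\<close> on \<open>T\<close>, and each
  block from the second on has 2-norm at most \<open>1 / sqrt s\<close> times the 1-norm of the preceding one.
  The restricted isometry property makes the images of disjoint blocks almost orthogonal, which
  bounds \<open>h\<close> on \<open>T\<close> and the first block. Only the real inner product of quaternion vectors is
  needed, so noncommutativity plays no role.
\<close>

section \<open>Restricting a vector to a set of positions\<close>

definition restrict_vec :: "'n set \<Rightarrow> 'a::zero ^ 'n \<Rightarrow> 'a ^ 'n" where
  "restrict_vec A x = (\<chi> i. if i \<in> A then x $ i else 0)"

lemma restrict_vec_nth [simp]: "restrict_vec A x $ i = (if i \<in> A then x $ i else 0)"
  by (simp add: restrict_vec_def)

lemma restrict_vec_empty [simp]: "restrict_vec {} x = 0"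
  by (simp add: vec_eq_iff)

lemma restrict_vec_Un_disjoint:
  fixes x :: "'a::monoid_add ^ 'n"
  assumes "A \<inter> B = {}"
  shows "restrict_vec (A \<union> B) x = restrict_vec A x + restrict_vec B x"
  using assms by (auto simp: vec_eq_iff)

lemma norm_restrict_vec_power2:
  fixes x :: "'a::real_normed_vector ^ 'n"
  shows "(norm (restrict_vec A x))\<^sup>2 = (\<Sum>i\<in>A. (norm (x $ i))\<^sup>2)"
proof -
  have "(norm (restrict_vec A x))\<^sup>2 = (\<Sum>i\<in>UNIV. (norm (restrict_vec A x $ i))\<^sup>2)"
    by (simp add: norm_vec_def L2_set_def sum_nonneg)
  also have "\<dots> = (\<Sum>i\<in>UNIV. if i \<in> A then (norm (x $ i))\<^sup>2 else 0)"
    by (intro sum.cong) auto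
  also have "\<dots> = (\<Sum>i\<in>A. (norm (x $ i))\<^sup>2)"
    by (simp flip: sum.inter_restrict)
  finally show ?thesis .
qed

lemma norm_restrict_vec_mono:
  fixes x :: "'a::real_normed_vector ^ 'n"
  assumes "A \<subseteq> B"
  shows "norm (restrict_vec A x) \<le> norm (restrict_vec B x)"
proof (rule power2_le_imp_le)
  show "(norm (restrict_vec A x))\<^sup>2 \<le> (norm (restrict_vec B x))\<^sup>2"
    unfolding norm_restrict_vec_power2 using assms by (intro sum_mono2) auto
qed simp

lemma l1_restrict_vec: "l1_norm (restrict_vec A x) = (\<Sum>i\<in>A. norm (x $ i))"
proof -
  have "l1_norm (restrict_vec A x) = (\<Sum>i\<in>UNIV. if i \<in> A then norm (x $ i) else 0)"
    unfolding l1_norm_def by (intro sum.cong) auto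
  then show ?thesis by (simp flip: sum.inter_restrict)
qed

lemma l1_restrict_vec_split:
  "l1_norm x = l1_norm (restrict_vec A x) + l1_norm (restrict_vec (- A) x)"
  unfolding l1_restrict_vec
  by (simp add: l1_norm_def Compl_eq_Diff_UNIV sum.subset_diff[of A UNIV])

lemma sparse_restrict_vec:
  assumes "card A \<le> k"
  shows "sparse k (restrict_vec A x)"
proof -
  have "{i. restrict_vec A x $ i \<noteq> 0} \<subseteq> A"
    by auto
  then have "card {i. restrict_vec A x $ i \<noteq> 0} \<le> card A"
    by (intro card_mono) auto
  then show ?thesis
    using assms unfolding sparse_def l0_norm_def by linarith
qed

text \<open>Cauchy-Schwarz against the constant 1 on \<open>A\<close>, which costs a factor
  \<open>card A\<close> in the squares.\<close>

lemma l1_restrict_vec_le: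
  assumes "card A \<le> s"
  shows "l1_norm (restrict_vec A x) \<le> sqrt s * norm (restrict_vec A x)"
proof (rule power2_le_imp_le)
  have "(l1_norm (restrict_vec A x))\<^sup>2 \<le> (norm (restrict_vec A x))\<^sup>2 * real (card A)"
    unfolding l1_restrict_vec norm_restrict_vec_power2
    by (rule sum_squared_le_sum_of_squares)
  also have "\<dots> \<le> (norm (restrict_vec A x))\<^sup>2 * real s"
    using assms by (intro mult_left_mono) auto
  finally show "(l1_norm (restrict_vec A x))\<^sup>2 \<le> (sqrt s * norm (restrict_vec A x))\<^sup>2"
    by (simp add: power_mult_distrib mult.commute)
qed simp

lemma norm_restrict_vec_le:
  fixes x :: "'a::real_normed_vector ^ 'n"
  assumes "card A \<le> s" "0 \<le> c" "\<And>i. i \<in> A \<Longrightarrow> norm (x $ i) \<le> c"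
  shows "norm (restrict_vec A x) \<le> sqrt s * c"
proof (rule power2_le_imp_le)
  have "(norm (restrict_vec A x))\<^sup>2 \<le> real (card A) * c\<^sup>2"
    unfolding norm_restrict_vec_power2 using assms by (intro sum_bounded_above power_mono) auto
  also have "\<dots> \<le> real s * c\<^sup>2"
    using assms by (intro mult_right_mono) auto
  finally show "(norm (restrict_vec A x))\<^sup>2 \<le> (sqrt s * c)\<^sup>2"
    by (simp add: power_mult_distrib)
qed (use assms in simp)

section \<open>Blocks of decreasing coordinates\<close>

lemma ex_largest_subset:
  fixes f :: "'a \<Rightarrow> 'b::linorder"
  assumes "finite A" "k \<le> card A"
  shows "\<exists>S\<subseteq>A. card S = k \<and> (\<forall>i\<in>S. \<forall>j\<in>A - S. f j \<le> f i)"
  using assms(2)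
proof (induction k)
  case 0
  show ?case by (intro exI[of _ "{}"]) simp
next
  case (Suc k)
  then obtain S where S: "S \<subseteq> A" "card S = k" "\<forall>i\<in>S. \<forall>j\<in>A - S. f j \<le> f i"
    by auto
  \<comment> \<open>Greedy choice: adding a maximizer of the remainder keeps every chosen value
    above every remaining one.\<close>
  have "A - S \<noteq> {}"
    using S Suc.prems by auto
  then have "Max (f ` (A - S)) \<in> f ` (A - S)"
    using assms(1) by (intro Max_in) auto
  then obtain m where m: "m \<in> A - S" "f m = Max (f ` (A - S))"
    by auto
  have "\<forall>j\<in>A - S. f j \<le> f m"
    unfolding m(2) using assms(1) by auto
  moreover have "finite S"
    using S(1) assms(1) finite_subset by blast
  ultimately show ?case
    using S m(1) by (intro exI[of _ "insert m S"]) auto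
qed

text \<open>Strong induction on \<open>card A\<close>: cut off the \<open>s\<close> largest
  positions \<open>S\<close> and let the induction hypothesis split the rest into a head
  \<open>B\<close> and a list \<open>Bs\<close>. Every coordinate on \<open>B\<close> is at most the
  mean over \<open>S\<close>, so the 1-norm on \<open>S\<close> pays for the 2-norm on
  \<open>B\<close>. The head stays outside the sum because no earlier block pays for it.\<close>

lemma block_decomposition:
  fixes h :: "quat ^ 'n"
  assumes "1 \<le> s"
  shows "\<exists>B Bs. B \<subseteq> A \<and> card B \<le> s \<and> (\<forall>C\<in>set Bs. C \<subseteq> A - B \<and> card C \<le> s) \<and>
           restrict_vec (A - B) h = (\<Sum>C\<leftarrow>Bs. restrict_vec C h) \<and>
           sqrt s * (\<Sum>C\<leftarrow>Bs. norm (restrict_vec C h)) \<le> l1_norm (restrict_vec A h)"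
proof (induction "card A" arbitrary: A rule: less_induct)
  case less
  show ?case
  proof (cases "card A \<le> s")
    case True
    then show ?thesis
      by (intro exI[of _ A] exI[of _ "[]"]) (simp add: l1_restrict_vec sum_nonneg)
  next
    case False
    then obtain S where S: "S \<subseteq> A" "card S = s" "\<forall>i\<in>S. \<forall>j\<in>A - S. norm (h $ j) \<le> norm (h $ i)"
      using ex_largest_subset[of A s "\<lambda>i. norm (h $ i)"] by auto
    \<comment> \<open>The decrease is strict because \<open>1 \<le> s\<close> makes \<open>S\<close>
      nonempty.\<close>
    have "card (A - S) < card A"
      using S assms False by (simp add: card_Diff_subset)
    from less[OF this] obtain B Bs where
      B: "B \<subseteq> A - S" "card B \<le> s" "\<forall>C\<in>set Bs. C \<subseteq> A - S - B \<and> card C \<le> s"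
      "restrict_vec (A - S - B) h = (\<Sum>C\<leftarrow>Bs. restrict_vec C h)"
      "sqrt s * (\<Sum>C\<leftarrow>Bs. norm (restrict_vec C h)) \<le> l1_norm (restrict_vec (A - S) h)"
      by blast
    define c where "c = l1_norm (restrict_vec S h) / s"
    have "norm (h $ j) \<le> c" if "j \<in> B" for j
    proof -
      have "real (card S) * norm (h $ j) \<le> l1_norm (restrict_vec S h)"
        unfolding l1_restrict_vec using that B(1) S(3) by (intro sum_bounded_below) auto
      then show ?thesis
        using assms S(2) by (simp add: c_def field_simps)
    qed
    moreover have "0 \<le> c"
      by (simp add: c_def l1_norm_def sum_nonneg)
    ultimately have "norm (restrict_vec B h) \<le> sqrt s * c"
      using B(2) by (intro norm_restrict_vec_le) auto
    \<comment> \<open>The two roots multiply to \<open>s\<close>, and \<open>s\<close> times the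
      mean \<open>c\<close> is the whole 1-norm on \<open>S\<close>.\<close>
    then have "sqrt s * norm (restrict_vec B h) \<le> sqrt s * (sqrt s * c)"
      by (intro mult_left_mono) auto
    also have "\<dots> = l1_norm (restrict_vec S h)"
      using assms by (simp add: c_def flip: mult.assoc)
    finally have "sqrt s * (\<Sum>C\<leftarrow>B # Bs. norm (restrict_vec C h))
        \<le> l1_norm (restrict_vec S h) + l1_norm (restrict_vec (A - S) h)"
      using B(5) by (simp add: distrib_left)
    also have "\<dots> = l1_norm (restrict_vec A h)"
      using S(1) by (simp add: l1_restrict_vec sum.subset_diff[of S A])
    finally have l1: "sqrt s * (\<Sum>C\<leftarrow>B # Bs. norm (restrict_vec C h)) \<le> l1_norm (restrict_vec A h)" .
    \<comment> \<open>\<open>S\<close> becomes the new head; the former head \<open>B\<close> moves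
      to the front of the list.\<close>
    have "A - S = B \<union> (A - S - B)"
      using B(1) by auto
    then have "restrict_vec (A - S) h = (\<Sum>C\<leftarrow>B # Bs. restrict_vec C h)"
      using restrict_vec_Un_disjoint[of B "A - S - B" h] B(4) by auto
    then show ?thesis
      using S B l1 by (intro exI[of _ S] exI[of _ "B # Bs"]) auto
  qed
qed

section \<open>Near-orthogonality of images under restricted isometry\<close>

lemma linear_matrix_vector_mult:
  fixes M :: "'a::real_algebra_1 ^ 'n ^ 'm"
  shows "linear (\<lambda>x. M *v x)"
  by (rule linearI)
    (simp_all add: vec_eq_iff matrix_vector_mult_def scaleR_right.sum distrib_left sum.distrib
      scaleR_sum_right)

lemma inner_restrict_vec_disjoint:
  fixes x :: "'a::real_inner ^ 'n"
  assumes "A \<inter> B = {}"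
  shows "restrict_vec A x \<bullet> restrict_vec B x = 0"
  unfolding inner_vec_def using assms by (intro sum.neutral) auto

lemma sparse_combination:
  assumes "card A \<le> s" "card B \<le> t"
  shows "sparse (s + t) (a *\<^sub>R restrict_vec A x + b *\<^sub>R restrict_vec B x)"
proof -
  have "a *\<^sub>R restrict_vec A x + b *\<^sub>R restrict_vec B x
      = restrict_vec (A \<union> B) (a *\<^sub>R restrict_vec A x + b *\<^sub>R restrict_vec B x)"
    by (auto simp: vec_eq_iff)
  moreover have "card (A \<union> B) \<le> s + t"
    using card_Un_le[of A B] assms by linarith
  ultimately show ?thesis
    using sparse_restrict_vec by metis
qed

text \<open>Combinations of the two restrictions are \<open>2 * s\<close>-sparse, so the isometry
  bounds apply to their sum and their difference. The sign is the one in which the cross terms enter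
  when the image of the head is expanded.\<close>

lemma restricted_isometry_inner_le:
  fixes \<Phi> :: "quat ^ 'n ^ 'm"
  assumes rip: "restricted_isometry \<Phi> (2 * s) \<delta>"
    and AB: "A \<inter> B = {}" "card A \<le> s" "card B \<le> s"
  shows "- ((\<Phi> *v restrict_vec A h) \<bullet> (\<Phi> *v restrict_vec B h))
           \<le> \<delta> * norm (restrict_vec A h) * norm (restrict_vec B h)"
proof -
  interpret \<Phi>: linear "\<lambda>x. \<Phi> *v x"
    by (rule linear_matrix_vector_mult)
  let ?u = "restrict_vec A h" and ?v = "restrict_vec B h"
  show ?thesis
  proof (cases "?u = 0 \<or> ?v = 0")
    case True
    then show ?thesis by (auto simp: \<Phi>.zero)
  next
    case False
    \<comment> \<open>Scaling by each other's norm makes the two vectors equally long; then polarize.\<close>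
    define a b where ab_def: "a = norm ?v" "b = norm ?u"
    have pos: "a * b > 0"
      using False by (simp add: ab_def)
    define p where "p = (\<Phi> *v ?u) \<bullet> (\<Phi> *v ?v)"
    have orth: "?u \<bullet> ?v = 0"
      using AB(1) by (rule inner_restrict_vec_disjoint)
    have expand: "(norm (a *\<^sub>R f + c *\<^sub>R g))\<^sup>2 = a\<^sup>2 * (norm f)\<^sup>2 + 2 * (a * c) * (f \<bullet> g) + c\<^sup>2 * (norm g)\<^sup>2"
      for c :: real and f g :: "quat ^ 'k"
      unfolding power2_norm_eq_inner
      by (simp add: inner_simps inner_commute power2_eq_square algebra_simps)
    \<comment> \<open>The condition on \<open>c\<close> covers both signs, \<open>c = b\<close> and
      \<open>c = - b\<close>, at once.\<close>
    have norms: "(norm (a *\<^sub>R ?u + c *\<^sub>R ?v))\<^sup>2 = 2 * (a * b)\<^sup>2" if "c\<^sup>2 = b\<^sup>2" for c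
      unfolding expand orth that by (simp add: ab_def power_mult_distrib)
    have images: "(norm (\<Phi> *v (a *\<^sub>R ?u + c *\<^sub>R ?v)))\<^sup>2
        = a\<^sup>2 * (norm (\<Phi> *v ?u))\<^sup>2 + 2 * (a * c) * p + c\<^sup>2 * (norm (\<Phi> *v ?v))\<^sup>2" for c
      unfolding \<Phi>.add \<Phi>.scaleR expand p_def ..
    have sp: "sparse (2 * s) (a *\<^sub>R ?u + c *\<^sub>R ?v)" for c
      using sparse_combination[OF AB(2,3)] by (simp add: mult_2)
    \<comment> \<open>The lower bound for the sum minus the upper bound for the difference: the
      squared norms of the images cancel and \<open>4 * (a * b) * p\<close> remains.\<close>
    have "(1 - \<delta>) * (2 * (a * b)\<^sup>2) \<le> (norm (\<Phi> *v (a *\<^sub>R ?u + b *\<^sub>R ?v)))\<^sup>2"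
      using rip sp[of b] norms[of b] unfolding restricted_isometry_def by metis
    moreover have "(norm (\<Phi> *v (a *\<^sub>R ?u + (- b) *\<^sub>R ?v)))\<^sup>2 \<le> (1 + \<delta>) * (2 * (a * b)\<^sup>2)"
      using rip sp[of "- b"] norms[of "- b"] unfolding restricted_isometry_def
      by (metis power2_minus)
    ultimately have "(a * b) * (- p) \<le> (a * b) * (\<delta> * (a * b))"
      unfolding images by (simp add: algebra_simps power2_eq_square)
    then have "- p \<le> \<delta> * (a * b)"
      using pos by (rule mult_left_le_imp_le)
    then show ?thesis
      by (simp add: p_def ab_def mult_ac)
  qed
qed

section \<open>The error on and off the head positions\<close>

lemma l1_minimizer_cone:
  fixes h x :: "quat ^ 'n"
  assumes "l1_norm (x + h) \<le> l1_norm x"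
  shows "l1_norm (restrict_vec (- T) h)
           \<le> l1_norm (restrict_vec T h) + 2 * l1_norm (restrict_vec (- T) x)"
proof -
  \<comment> \<open>The reverse triangle inequality is used in opposite directions: on
    \<open>T\<close> the coordinates of \<open>h\<close> are subtracted from those of
    \<open>x\<close>, off \<open>T\<close> those of \<open>x\<close> from those of
    \<open>h\<close>.\<close>
  have "(\<Sum>i\<in>T. norm (x $ i) - norm (h $ i)) \<le> (\<Sum>i\<in>T. norm ((x + h) $ i))"
    by (intro sum_mono) (simp add: norm_diff_ineq)
  moreover have "(\<Sum>i\<in>- T. norm (h $ i) - norm (x $ i)) \<le> (\<Sum>i\<in>- T. norm ((x + h) $ i))"
    by (intro sum_mono) (metis add.commute norm_diff_ineq vector_add_component)
  ultimately show ?thesis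
    using assms l1_restrict_vec_split[of "x + h" T] l1_restrict_vec_split[of x T]
    by (simp add: l1_restrict_vec sum_subtractf)
qed

text \<open>Write the image of the head as the image of \<open>h\<close> minus that of the tail and
  take the inner product with the image of the head. Cauchy-Schwarz bounds the first term and
  near-orthogonality the second; dividing by the norm of the head gives the claim.\<close>

lemma restricted_isometry_head_bound:
  fixes \<Phi> :: "quat ^ 'n ^ 'm"
  assumes rip: "restricted_isometry \<Phi> (2 * s) \<delta>"
    and T: "card T \<le> s" and B: "B \<subseteq> - T" "card B \<le> s"
    and Bs: "\<forall>C\<in>set Bs. C \<subseteq> - T - B \<and> card C \<le> s"
    and tail: "restrict_vec (- T - B) h = (\<Sum>C\<leftarrow>Bs. restrict_vec C h)"
  shows "(1 - \<delta>) * norm (restrict_vec (T \<union> B) h)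
           \<le> sqrt (1 + \<delta>) * norm (\<Phi> *v h) + sqrt 2 * \<delta> * (\<Sum>C\<leftarrow>Bs. norm (restrict_vec C h))"
proof -
  interpret \<Phi>: linear "\<lambda>x. \<Phi> *v x"
    by (rule linear_matrix_vector_mult)
  let ?t = "restrict_vec T h" and ?b = "restrict_vec B h" and ?u = "restrict_vec (T \<union> B) h"
  define \<sigma> where "\<sigma> = (\<Sum>C\<leftarrow>Bs. norm (restrict_vec C h))"
  have \<delta>: "0 \<le> \<delta>"
    using rip by (simp add: restricted_isometry_def)
  have \<sigma>: "0 \<le> \<sigma>"
    unfolding \<sigma>_def by (intro sum_list_nonneg) auto
  have disj: "T \<inter> B = {}"
    using B(1) by auto
  have u: "?u = ?t + ?b"
    using disj by (rule restrict_vec_Un_disjoint)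
  have "h = restrict_vec ((T \<union> B) \<union> (- T - B)) h"
    by (auto simp: vec_eq_iff)
  also have "\<dots> = ?u + restrict_vec (- T - B) h"
    by (rule restrict_vec_Un_disjoint) auto
  finally have h: "\<Phi> *v h = \<Phi> *v ?u + \<Phi> *v restrict_vec (- T - B) h"
    by (metis \<Phi>.add)
  \<comment> \<open>\<open>D\<close> will be \<open>T\<close> or \<open>B\<close> and not their
    union: \<open>D\<close> and a block \<open>C\<close> then have at most \<open>2 * s\<close>
    positions together.\<close>
  have cross: "- ((\<Phi> *v restrict_vec D h) \<bullet> (\<Phi> *v restrict_vec (- T - B) h))
      \<le> \<delta> * norm (restrict_vec D h) * \<sigma>"
    if D: "D \<subseteq> T \<union> B" "card D \<le> s" for D
  proof -
    let ?f = "restrict_vec D h"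
    \<comment> \<open>Allowing any list with elements from \<open>Bs\<close> keeps the facts about
      the blocks available in the induction.\<close>
    have "- ((\<Phi> *v ?f) \<bullet> (\<Phi> *v (\<Sum>C\<leftarrow>Cs. restrict_vec C h)))
        \<le> \<delta> * norm ?f * (\<Sum>C\<leftarrow>Cs. norm (restrict_vec C h))"
      if "set Cs \<subseteq> set Bs" for Cs
      using that
    proof (induction Cs)
      case Nil
      then show ?case by (simp add: \<Phi>.zero)
    next
      case (Cons C Cs)
      have "- ((\<Phi> *v ?f) \<bullet> (\<Phi> *v restrict_vec C h)) \<le> \<delta> * norm ?f * norm (restrict_vec C h)"
        using Cons.prems Bs D by (intro restricted_isometry_inner_le[OF rip]) auto
      then show ?case
        using Cons by (simp add: \<Phi>.add inner_add_right distrib_left)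
    qed
    from this[of Bs] show ?thesis
      by (simp add: tail \<sigma>_def)
  qed
  \<comment> \<open>Treating \<open>T\<close> and \<open>B\<close> separately costs the factor
    \<open>sqrt 2\<close>: by orthogonality and \<open>2 * a * b \<le> a^2 + b^2\<close>, the sum of
    the two norms is at most \<open>sqrt 2\<close> times the norm of the head.\<close>
  have "?t \<bullet> ?b = 0"
    using disj by (rule inner_restrict_vec_disjoint)
  then have "(norm ?u)\<^sup>2 = (norm ?t)\<^sup>2 + (norm ?b)\<^sup>2"
    unfolding u power2_norm_eq_inner by (simp add: inner_simps inner_commute)
  then have "(norm ?t + norm ?b)\<^sup>2 \<le> (sqrt 2 * norm ?u)\<^sup>2"
    using sum_squares_bound[of "norm ?t" "norm ?b"] by (simp add: power_mult_distrib power2_sum)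
  then have tb: "norm ?t + norm ?b \<le> sqrt 2 * norm ?u"
    by (rule power2_le_imp_le) simp
  have "card (T \<union> B) \<le> 2 * s"
    using card_Un_le[of T B] T B(2) by linarith
  then have "sparse (2 * s) ?u"
    by (rule sparse_restrict_vec)
  then have rip_u: "(1 - \<delta>) * (norm ?u)\<^sup>2 \<le> (norm (\<Phi> *v ?u))\<^sup>2"
    "(norm (\<Phi> *v ?u))\<^sup>2 \<le> (1 + \<delta>) * (norm ?u)\<^sup>2"
    using rip unfolding restricted_isometry_def by blast+
  have up: "norm (\<Phi> *v ?u) \<le> sqrt (1 + \<delta>) * norm ?u"
    by (rule power2_le_imp_le) (use rip_u \<delta> in \<open>simp_all add: power_mult_distrib\<close>)
  have "(norm (\<Phi> *v ?u))\<^sup>2 = (\<Phi> *v ?u) \<bullet> (\<Phi> *v h)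
      - (\<Phi> *v ?t) \<bullet> (\<Phi> *v restrict_vec (- T - B) h) - (\<Phi> *v ?b) \<bullet> (\<Phi> *v restrict_vec (- T - B) h)"
    unfolding h power2_norm_eq_inner by (simp add: u \<Phi>.add inner_simps)
  also have "\<dots> \<le> norm (\<Phi> *v ?u) * norm (\<Phi> *v h) + \<delta> * norm ?t * \<sigma> + \<delta> * norm ?b * \<sigma>"
    using norm_cauchy_schwarz[of "\<Phi> *v ?u" "\<Phi> *v h"] cross[of T] cross[of B] T B by auto
  also have "\<dots> = norm (\<Phi> *v ?u) * norm (\<Phi> *v h) + \<delta> * \<sigma> * (norm ?t + norm ?b)"
    by (simp add: algebra_simps)
  also have "\<dots> \<le> sqrt (1 + \<delta>) * norm ?u * norm (\<Phi> *v h) + \<delta> * \<sigma> * (sqrt 2 * norm ?u)"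
    using up tb \<delta> \<sigma> by (intro add_mono mult_right_mono mult_left_mono) auto
  finally have "norm ?u * ((1 - \<delta>) * norm ?u)
      \<le> norm ?u * (sqrt (1 + \<delta>) * norm (\<Phi> *v h) + sqrt 2 * \<delta> * \<sigma>)"
    using rip_u(1) by (simp add: power2_eq_square algebra_simps)
  \<comment> \<open>If the head vanishes there is nothing to cancel, but then the left side is 0 and
    the right side nonnegative.\<close>
  then show ?thesis
    using \<delta> \<sigma> by (cases "norm ?u = 0") (auto simp: \<sigma>_def[symmetric] mult_le_cancel_left)
qed

section \<open>Assembling the error bound and its constants\<close>

theorem theorem4p1:
  fixes \<Phi> :: "quat ^ 'n ^ 'm"
    and s :: nat
    and \<delta> \<eta> :: real
    and x x\<^sub>s x_sharp :: "quat ^ 'n"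
    and y e :: "quat ^ 'm"
  assumes "s \<ge> 1"
    and "restricted_isometry \<Phi> (2 * s) \<delta>"
    and "\<delta> < sqrt 2 - 1"
    and "\<eta> \<ge> 0"
    and "y = \<Phi> *v x + e"
    and "norm e \<le> \<eta>"
    and "is_arg_min l1_norm (\<lambda>z. norm (\<Phi> *v z - y) \<le> \<eta>) x_sharp"
    and "best_sparse_approx s x x\<^sub>s"
  shows "norm (x_sharp - x) \<le>
           (2 * ((1 + (sqrt 2 - 1) * \<delta>) / (1 - (sqrt 2 + 1) * \<delta>))) / sqrt (real s) * l1_norm (x - x\<^sub>s)
           + (4 * sqrt (1 + \<delta>) / (1 - (sqrt 2 + 1) * \<delta>)) * \<eta>"
proof -
  interpret \<Phi>: linear "\<lambda>x. \<Phi> *v x"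
    by (rule linear_matrix_vector_mult)
  define h where "h = x_sharp - x"
  obtain T where T: "card T = min s CARD('n)" "x\<^sub>s = restrict_vec T x"
    using assms(8) unfolding best_sparse_approx_def restrict_vec_def by blast
  then have cT: "card T \<le> s" by simp
  obtain B Bs where B: "B \<subseteq> - T" "card B \<le> s" "\<forall>C\<in>set Bs. C \<subseteq> - T - B \<and> card C \<le> s"
    and tail: "restrict_vec (- T - B) h = (\<Sum>C\<leftarrow>Bs. restrict_vec C h)"
    and \<sigma>: "sqrt s * (\<Sum>C\<leftarrow>Bs. norm (restrict_vec C h)) \<le> l1_norm (restrict_vec (- T) h)"
    using block_decomposition[OF assms(1), of "- T" h] by blast
  define \<sigma> where "\<sigma> = (\<Sum>C\<leftarrow>Bs. norm (restrict_vec C h))"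
  define u where "u = norm (restrict_vec (T \<union> B) h)"
  define \<epsilon> where "\<epsilon> = l1_norm (x - x\<^sub>s) / sqrt s"
  define d where "d = 1 - (sqrt 2 + 1) * \<delta>"
  have \<delta>: "0 \<le> \<delta>"
    using assms(2) by (simp add: restricted_isometry_def)
  \<comment> \<open>Since \<open>(sqrt 2 + 1) * (sqrt 2 - 1) = 1\<close>, the bound on
    \<open>\<delta>\<close> says exactly that the denominator \<open>d\<close> is positive.\<close>
  have "(sqrt 2 + 1) * \<delta> < (sqrt 2 + 1) * (sqrt 2 - 1)"
    using assms(3) by (intro mult_strict_left_mono) (auto intro: add_pos_pos)
  then have d: "0 < d"
    by (simp add: d_def algebra_simps)
  have s: "0 < sqrt s"
    using assms(1) by simp

  have feasible: "norm (\<Phi> *v x_sharp - y) \<le> \<eta>"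
    using assms(7) by (simp add: is_arg_min_def)
  \<comment> \<open>\<open>x\<close> is itself feasible, its residual being \<open>- e\<close>, so
    the minimizer can be compared with it.\<close>
  have "norm (\<Phi> *v x - y) \<le> \<eta>"
    using assms(5,6) by simp
  then have "l1_norm x_sharp \<le> l1_norm x"
    using assms(7) unfolding is_arg_min_def by (meson not_le)
  then have min: "l1_norm (x + h) \<le> l1_norm x"
    by (simp add: h_def)
  have "\<Phi> *v h = (\<Phi> *v x_sharp - y) + e"
    by (simp add: h_def \<Phi>.diff assms(5))
  then have \<Phi>h: "norm (\<Phi> *v h) \<le> 2 * \<eta>"
    using norm_triangle_ineq[of "\<Phi> *v x_sharp - y" e] feasible assms(6) by simp

  have "x - x\<^sub>s = restrict_vec (- T) x"
    by (auto simp: T(2) vec_eq_iff)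
  then have eps: "l1_norm (restrict_vec (- T) x) = sqrt s * \<epsilon>"
    using s by (simp add: \<epsilon>_def)
  have "sqrt s * \<sigma> \<le> l1_norm (restrict_vec T h) + 2 * (sqrt s * \<epsilon>)"
    using \<sigma> l1_minimizer_cone[OF min, of T] eps unfolding \<sigma>_def by simp
  also have "\<dots> \<le> sqrt s * u + 2 * (sqrt s * \<epsilon>)"
  proof -
    have "l1_norm (restrict_vec T h) \<le> sqrt s * norm (restrict_vec T h)"
      using cT by (rule l1_restrict_vec_le)
    also have "\<dots> \<le> sqrt s * u"
      unfolding u_def by (intro mult_left_mono norm_restrict_vec_mono) auto
    finally show ?thesis by simp
  qed
  finally have "sqrt s * \<sigma> \<le> sqrt s * (u + 2 * \<epsilon>)"
    by (simp add: algebra_simps)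
  then have \<sigma>_le: "\<sigma> \<le> u + 2 * \<epsilon>"
    using s by simp

  \<comment> \<open>Inserting the bound on \<open>\<sigma>\<close> puts
    \<open>sqrt 2 * \<delta> * u\<close> on the right; moved to the left it turns the coefficient
    \<open>1 - \<delta>\<close> into \<open>d\<close>.\<close>
  have "(1 - \<delta>) * u \<le> sqrt (1 + \<delta>) * norm (\<Phi> *v h) + sqrt 2 * \<delta> * \<sigma>"
    unfolding u_def \<sigma>_def by (rule restricted_isometry_head_bound[OF assms(2) cT B tail])
  also have "\<dots> \<le> sqrt (1 + \<delta>) * (2 * \<eta>) + sqrt 2 * \<delta> * (u + 2 * \<epsilon>)"
    using \<Phi>h \<sigma>_le \<delta> by (intro add_mono mult_left_mono) auto
  finally have u_le: "d * u \<le> 2 * sqrt (1 + \<delta>) * \<eta> + 2 * sqrt 2 * \<delta> * \<epsilon>"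
    by (simp add: d_def algebra_simps)

  \<comment> \<open>Head plus tail: the tail is at most \<open>\<sigma>\<close>, hence at most
    \<open>u + 2 * \<epsilon>\<close>, which doubles the bound for the head.\<close>
  have "h = restrict_vec ((T \<union> B) \<union> (- T - B)) h"
    by (auto simp: vec_eq_iff)
  also have "\<dots> = restrict_vec (T \<union> B) h + restrict_vec (- T - B) h"
    by (rule restrict_vec_Un_disjoint) auto
  finally have "norm h \<le> u + norm (restrict_vec (- T - B) h)"
    unfolding u_def by (metis norm_triangle_ineq)
  moreover have "norm (\<Sum>C\<leftarrow>Cs. restrict_vec C h) \<le> (\<Sum>C\<leftarrow>Cs. norm (restrict_vec C h))" for Cs
    by (induction Cs) (auto intro: norm_triangle_mono)
  then have "norm (restrict_vec (- T - B) h) \<le> \<sigma>"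
    unfolding tail \<sigma>_def .
  ultimately have "norm h \<le> 2 * u + 2 * \<epsilon>"
    using \<sigma>_le by simp
  then have "d * norm h \<le> 2 * (d * u) + 2 * d * \<epsilon>"
    using mult_left_mono[of "norm h" "2 * u + 2 * \<epsilon>" d] d by (simp add: algebra_simps)
  also have "\<dots> \<le> 2 * (2 * sqrt (1 + \<delta>) * \<eta> + 2 * sqrt 2 * \<delta> * \<epsilon>) + 2 * d * \<epsilon>"
    using u_le by simp
  \<comment> \<open>The coefficient of \<open>\<epsilon>\<close> is
    \<open>4 * sqrt 2 * \<delta> + 2 * d\<close>, the numerator of the first constant.\<close>
  also have "\<dots> = 2 * (1 + (sqrt 2 - 1) * \<delta>) * \<epsilon> + 4 * sqrt (1 + \<delta>) * \<eta>"
    by (simp add: d_def algebra_simps)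
  finally have "norm h \<le> (2 * (1 + (sqrt 2 - 1) * \<delta>) * \<epsilon> + 4 * sqrt (1 + \<delta>) * \<eta>) / d"
    using d by (simp add: pos_le_divide_eq mult.commute)
  then show ?thesis
    unfolding h_def[symmetric] d_def[symmetric] \<epsilon>_def 
    by (simp add: add_divide_distrib diff_divide_distrib ring_distribs mult_ac)
qed

end
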